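(* Suppose that the following assumptions hold. (1) (Balanced panel of groups) $N_{g,t}>0$ for all $(g,t)\in\{1,\dots,G\}\times\{1,\dots,T\}$. (2) (Sharp design) $D_{i,g,t}=D_{g,t}$ for all $(g,t)$ and all $i\in\{1,\dots,N_{g,t}\}$. (3) (Strong exogeneity for $Y(0)$ and $Y(1)$) For each $d\in\{0,1\}$, all $g\in\{1,\dots,G\}$ and all $t\in\{2,\dots,T\}$, $E(Y_{g,t}(d)-Y_{g,t-1}(d)\mid D_{g,1},\dots,D_{g,T})=E(Y_{g,t}(d)-Y_{g,t-1}(d))$. (4) (Common trends for $Y(0)$ and $Y(1)$) For each $d\in\{0,1\}$ and every $t\in\{2,\dots,T\}$, $E(Y_{g,t}(d)-Y_{g,t-1}(d))$ does not vary across $g$. (5) (Mean independence between a group's outcome and other groups' treatments) For all $g$ and $t$, $E(Y_{g,t}(0)\mid\boldsymbol D)=E(Y_{g,t}(0)\mid\boldsymbol D_g)$ and $E(Y_{g,t}(1)\mid\boldsymbol D)=E(Y_{g,t}(1)\mid\boldsymbol D_g)$. (6) (Existence of stable groups for the placebo test) For all $t\in\{3,\dots,T\}$: (i) if there is at least one $g$ with $D_{g,t-2}=D_{g,t-1}=0$ and $D_{g,t}=1$, then there exists at least one $g'\ne g$ with $D_{g',t-2}=D_{g',t-1}=D_{g',t}=0$; (ii) if there is at least one $g$ with $D_{g,t-2}=D_{g,t-1}=1$ and $D_{g,t}=0$, then there exists at least one $g'\neq g$ with $D_{g',t-2}=D_{g',t-1}=D_{g',t}=1$. Then $E[\mathrm{DID}^{\mathrm{pl}}_{\mathrm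 M}]=0$.
   Context: Setting. There are $G$ groups and $T\ge 3$ periods; $N_{g,t}$ is the (non-random) number of observations in cell $(g,t)\in\{1,\dots,G\}\times\{1,\dots,T\}$. Observation $i\in\{1,\dots,N_{g,t}\}$ of cell $(g,t)$ has a binary treatment $D_{i,g,t}\in\{0,1\}$, potential outcomes $Y_{i,g,t}(0),Y_{i,g,t}(1)$ and observed outcome $Y_{i,g,t}=Y_{i,g,t}(D_{i,g,t})$. Treatments and potential outcomes are random variables, and potential outcomes have finite expectations. Cell averages: $D_{g,t}=\frac1{N_{g,t}}\sum_i D_{i,g,t}$, $Y_{g,t}(d)=\frac1{N_{g,t}}\sum_i Y_{i,g,t}(d)$ for $d\in\{0,1\}$, $Y_{g,t}=\frac1{N_{g,t}}\sum_i Y_{i,g,t}$. $\boldsymbol D_g=(D_{g,1},\dots,D_{g,T})$ and $\boldsymbol D=(D_{g,t})_{(g,t)\in\{1,\dots,G\}\times\{1,\dots,T\}}$. Placebo estimator. For $t\in\{3,\dots,T\}$ and $(d,d',d'')\in\{0,1\}^3$, $N_{d,d',d'',t}=\sum_{g:D_{g,t}=d,\,D_{g,t-1}=d',\,D_{g,t-2}=d''}N_{g,t}$. Let $N_S^{\mathrm{pl}}=\sum_{(g,t):t\ge3,\,D_{g,t}\ne D_{g,t-1}=D_{g,t-2}}N_{g,t}$, assumed positive (almost surely), $$\mathrm{DID}^{\mathrm{pl}}_{+,t}=\sum_{g:D_{g,t}=1,D_{g,t-1}=D_{g,t-2}=0}\frac{N_{g,t}}{N_{1,0,0,t}}(Y_{g,t-1}-Y_{g,t-2})-\sum_{g:D_{g,t}=D_{g,t-1}=D_{g,t-2}=0}\frac{N_{g,t}}{N_{0,0,0,t}}(Y_{g,t-1}-Y_{g,t-2}),$$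 $$\mathrm{DID}^{\mathrm{pl}}_{-,t}=\sum_{g:D_{g,t}=D_{g,t-1}=D_{g,t-2}=1}\frac{N_{g,t}}{N_{1,1,1,t}}(Y_{g,t-1}-Y_{g,t-2})-\sum_{g:D_{g,t}=0,D_{g,t-1}=D_{g,t-2}=1}\frac{N_{g,t}}{N_{0,1,1,t}}(Y_{g,t-1}-Y_{g,t-2}),$$ with the convention that $\mathrm{DID}^{\mathrm{pl}}_{+,t}=0$ (resp. $\mathrm{DID}^{\mathrm{pl}}_{-,t}=0$) whenever one of the two sets of groups entering its definition is empty. Finally $$\mathrm{DID}^{\mathrm{pl}}_{\mathrm M}=\sum_{t=3}^T\left(\frac{N_{1,0,0,t}}{N_S^{\mathrm{pl}}}\mathrm{DID}^{\mathrm{pl}}_{+,t}+\frac{N_{0,1,1,t}}{N_S^{\mathrm{pl}}}\mathrm{DID}^{\mathrm{pl}}_{-,t}\right).$$ *)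

theory Defs
  imports "HOL-Probability.Probability"
begin

text \<open>
  Indices run over g in {1..G}, t in {1..T} and i in {1..N g t}. Arguments are ordered
  as in the usual subscript notation: \<open>D i g t \<omega>\<close> is the treatment of
  observation i in cell (g,t), and \<open>Y i g t d \<omega>\<close> its potential outcome under
  treatment d.
\<close>

definition observed_outcome ::
  "(nat \<Rightarrow> nat \<Rightarrow> nat \<Rightarrow> 'a \<Rightarrow> nat) \<Rightarrow> (nat \<Rightarrow> nat \<Rightarrow> nat \<Rightarrow> nat \<Rightarrow> 'a \<Rightarrow> real)
     \<Rightarrow> nat \<Rightarrow> nat \<Rightarrow> nat \<Rightarrow> 'a \<Rightarrow> real" where
  "observed_outcome D Y i g t \<omega> = Y i g t (D i g t \<omega>) \<omega>"

definition cell_avg ::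
  "(nat \<Rightarrow> nat \<Rightarrow> nat) \<Rightarrow> (nat \<Rightarrow> nat \<Rightarrow> nat \<Rightarrow> 'a \<Rightarrow> real) \<Rightarrow> nat \<Rightarrow> nat \<Rightarrow> 'a \<Rightarrow> real" where
  "cell_avg N X g t \<omega> = (\<Sum>i=1..N g t. X i g t \<omega>) / real (N g t)"

definition cell_treatment ::
  "(nat \<Rightarrow> nat \<Rightarrow> nat) \<Rightarrow> (nat \<Rightarrow> nat \<Rightarrow> nat \<Rightarrow> 'a \<Rightarrow> nat) \<Rightarrow> nat \<Rightarrow> nat \<Rightarrow> 'a \<Rightarrow> real" where
  "cell_treatment N D = cell_avg N (\<lambda>i g t \<omega>. real (D i g t \<omega>))"

definition cell_potential ::
  "(nat \<Rightarrow> nat \<Rightarrow> nat) \<Rightarrow> (nat \<Rightarrow> nat \<Rightarrow> nat \<Rightarrow> nat \<Rightarrow> 'a \<Rightarrow> real)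
     \<Rightarrow> nat \<Rightarrow> nat \<Rightarrow> nat \<Rightarrow> 'a \<Rightarrow> real" where
  "cell_potential N Y d = cell_avg N (\<lambda>i g t. Y i g t d)"

definition cell_outcome ::
  "(nat \<Rightarrow> nat \<Rightarrow> nat) \<Rightarrow> (nat \<Rightarrow> nat \<Rightarrow> nat \<Rightarrow> 'a \<Rightarrow> nat)
     \<Rightarrow> (nat \<Rightarrow> nat \<Rightarrow> nat \<Rightarrow> nat \<Rightarrow> 'a \<Rightarrow> real) \<Rightarrow> nat \<Rightarrow> nat \<Rightarrow> 'a \<Rightarrow> real" where
  "cell_outcome N D Y = cell_avg N (observed_outcome D Y)"

text \<open>
  The sigma-algebras generated by the random vectors $(D_{g,1},\dots,D_{g,T})$ and
  $(D_{g,t})_{(g,t)}$; conditioning on a random vector means conditioning on these.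
\<close>

definition sigma_group ::
  "'a measure \<Rightarrow> nat \<Rightarrow> (nat \<Rightarrow> nat \<Rightarrow> 'a \<Rightarrow> real) \<Rightarrow> nat \<Rightarrow> 'a measure" where
  "sigma_group M T Dc g =
     vimage_algebra (space M) (\<lambda>\<omega>. \<lambda>t\<in>{1..T}. Dc g t \<omega>) (\<Pi>\<^sub>M t\<in>{1..T}. borel)"

definition sigma_all ::
  "'a measure \<Rightarrow> nat \<Rightarrow> nat \<Rightarrow> (nat \<Rightarrow> nat \<Rightarrow> 'a \<Rightarrow> real) \<Rightarrow> 'a measure" where
  "sigma_all M G T Dc =
     vimage_algebra (space M) (\<lambda>\<omega>. \<lambda>(g, t)\<in>{1..G} \<times> {1..T}. Dc g t \<omega>)
       (\<Pi>\<^sub>M p\<in>{1..G} \<times> {1..T}. borel)"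

text \<open>
  The placebo estimator, as a function of the cell averages \<open>Dc\<close>, \<open>Yc\<close> of
  treatments and observed outcomes. In \<open>groups_path\<close> and \<open>N_path\<close>, the arguments
  d, d1, d2 are the treatments in periods t, t - 1 and t - 2.
\<close>

definition groups_path ::
  "nat \<Rightarrow> (nat \<Rightarrow> nat \<Rightarrow> 'a \<Rightarrow> real) \<Rightarrow> real \<Rightarrow> real \<Rightarrow> real \<Rightarrow> nat \<Rightarrow> 'a \<Rightarrow> nat set" where
  "groups_path G Dc d d1 d2 t \<omega> =
     {g \<in> {1..G}. Dc g t \<omega> = d \<and> Dc g (t - 1) \<omega> = d1 \<and> Dc g (t - 2) \<omega> = d2}"

definition N_path ::
  "nat \<Rightarrow> (nat \<Rightarrow> nat \<Rightarrow> nat) \<Rightarrow> (nat \<Rightarrow> nat \<Rightarrow> 'a \<Rightarrow> real)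
     \<Rightarrow> real \<Rightarrow> real \<Rightarrow> real \<Rightarrow> nat \<Rightarrow> 'a \<Rightarrow> nat" where
  "N_path G N Dc d d1 d2 t \<omega> = (\<Sum>g\<in>groups_path G Dc d d1 d2 t \<omega>. N g t)"

definition N_S_pl ::
  "nat \<Rightarrow> nat \<Rightarrow> (nat \<Rightarrow> nat \<Rightarrow> nat) \<Rightarrow> (nat \<Rightarrow> nat \<Rightarrow> 'a \<Rightarrow> real) \<Rightarrow> 'a \<Rightarrow> nat" where
  "N_S_pl G T N Dc \<omega> =
     (\<Sum>(g, t) \<in> {(g, t). g \<in> {1..G} \<and> t \<in> {3..T} \<and>
         Dc g t \<omega> \<noteq> Dc g (t - 1) \<omega> \<and> Dc g (t - 1) \<omega> = Dc g (t - 2) \<omega>}. N g t)"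

definition path_mean_lagged_diff ::
  "nat \<Rightarrow> (nat \<Rightarrow> nat \<Rightarrow> nat) \<Rightarrow> (nat \<Rightarrow> nat \<Rightarrow> 'a \<Rightarrow> real) \<Rightarrow> (nat \<Rightarrow> nat \<Rightarrow> 'a \<Rightarrow> real)
     \<Rightarrow> real \<Rightarrow> real \<Rightarrow> real \<Rightarrow> nat \<Rightarrow> 'a \<Rightarrow> real" where
  "path_mean_lagged_diff G N Dc Yc d d1 d2 t \<omega> =
     (\<Sum>g\<in>groups_path G Dc d d1 d2 t \<omega>.
        real (N g t) / real (N_path G N Dc d d1 d2 t \<omega>) * (Yc g (t - 1) \<omega> - Yc g (t - 2) \<omega>))"

definition DID_pl_plus ::
  "nat \<Rightarrow> (nat \<Rightarrow> nat \<Rightarrow> nat) \<Rightarrow> (nat \<Rightarrow> nat \<Rightarrow> 'a \<Rightarrow> real) \<Rightarrow> (nat \<Rightarrow> nat \<Rightarrow> 'a \<Rightarrow> real)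
     \<Rightarrow> nat \<Rightarrow> 'a \<Rightarrow> real" where
  "DID_pl_plus G N Dc Yc t \<omega> =
     (if groups_path G Dc 1 0 0 t \<omega> = {} \<or> groups_path G Dc 0 0 0 t \<omega> = {} then 0
      else path_mean_lagged_diff G N Dc Yc 1 0 0 t \<omega>
         - path_mean_lagged_diff G N Dc Yc 0 0 0 t \<omega>)"

definition DID_pl_minus ::
  "nat \<Rightarrow> (nat \<Rightarrow> nat \<Rightarrow> nat) \<Rightarrow> (nat \<Rightarrow> nat \<Rightarrow> 'a \<Rightarrow> real) \<Rightarrow> (nat \<Rightarrow> nat \<Rightarrow> 'a \<Rightarrow> real)
     \<Rightarrow> nat \<Rightarrow> 'a \<Rightarrow> real" where
  "DID_pl_minus G N Dc Yc t \<omega> =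
     (if groups_path G Dc 1 1 1 t \<omega> = {} \<or> groups_path G Dc 0 1 1 t \<omega> = {} then 0
      else path_mean_lagged_diff G N Dc Yc 1 1 1 t \<omega>
         - path_mean_lagged_diff G N Dc Yc 0 1 1 t \<omega>)"

definition DID_pl_M ::
  "nat \<Rightarrow> nat \<Rightarrow> (nat \<Rightarrow> nat \<Rightarrow> nat) \<Rightarrow> (nat \<Rightarrow> nat \<Rightarrow> 'a \<Rightarrow> real) \<Rightarrow> (nat \<Rightarrow> nat \<Rightarrow> 'a \<Rightarrow> real)
     \<Rightarrow> 'a \<Rightarrow> real" where
  "DID_pl_M G T N Dc Yc \<omega> =
     (\<Sum>t=3..T.
        real (N_path G N Dc 1 0 0 t \<omega>) / real (N_S_pl G T N Dc \<omega>) * DID_pl_plus G N Dc Yc t \<omega>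
      + real (N_path G N Dc 0 1 1 t \<omega>) / real (N_S_pl G T N Dc \<omega>) * DID_pl_minus G N Dc Yc t \<omega>)"

end

theory Submission imports Defs begin

text \<open>
  The estimator is linear in the lagged outcome differences, with bounded weights that are functions
  of the treatments alone and that, for each period and each type of switch, sum to zero over the
  groups. A group with non-zero weight has the same treatment d in periods t - 1 and t - 2, so that
  its lagged outcome difference is that of the potential outcomes under d. Given all treatments,
  this difference has a mean that does not depend on the group, so the weighted sum has mean zero.
\<close>

section \<open>Weighted integrals when the conditional mean is constant\<close>

lemma subalgebra_vimage_algebra:
  assumes "f \<in> M \<rightarrow>\<^sub>M N"
  shows "subalgebra M (vimage_algebra (space M) f N)"
  using assms measurable_space[OF assms]
  by (auto simp: subalgebra_def sets_vimage_algebra2 measurable_sets)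

lemma (in prob_space) sigma_finite_subalgebra_vimage_algebra:
  assumes "f \<in> M \<rightarrow>\<^sub>M N"
  shows "sigma_finite_subalgebra M (vimage_algebra (space M) f N)"
  by (intro finite_measure_subalgebra_is_sigma_finite finite_measure_subalgebra.intro
      finite_measure_subalgebra_axioms.intro subalgebra_vimage_algebra assms) unfold_locales

text \<open>Since \<open>W\<close> is \<open>F\<close>-measurable, \<open>Z\<close> may be replaced
  by its conditional expectation under the integral, and that is the constant \<open>m\<close>.
  Boundedness of \<open>W\<close> makes the product integrable, which this replacement
  requires.\<close>

lemma (in prob_space) integral_weighted_const_cond_exp:
  fixes W Z :: "'a \<Rightarrow> real"
  assumes F: "sigma_finite_subalgebra M F"
    and W: "W \<in> borel_measurable F" and bound: "\<And>\<omega>. \<bar>W \<omega>\<bar> \<le> K"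
    and Z: "integrable M Z"
    and ce: "AE \<omega> in M. real_cond_exp M F Z \<omega> = m"
  shows "integrable M (\<lambda>\<omega>. W \<omega> * Z \<omega>)" "(\<integral>\<omega>. W \<omega> * Z \<omega> \<partial>M) = m * (\<integral>\<omega>. W \<omega> \<partial>M)"
proof -
  interpret sigma_finite_subalgebra M F by (rule F)
  have WM[measurable]: "W \<in> borel_measurable M"
    using measurable_from_subalg[OF subalg W] .
  have Zm[measurable]: "Z \<in> borel_measurable M" using Z by auto
  show int: "integrable M (\<lambda>\<omega>. W \<omega> * Z \<omega>)"
  proof (rule Bochner_Integration.integrable_bound)
    show "integrable M (\<lambda>\<omega>. K * Z \<omega>)" using Z by simp
    show "AE \<omega> in M. norm (W \<omega> * Z \<omega>) \<le> norm (K * Z \<omega>)"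
      using bound by (auto simp: abs_mult intro!: mult_right_mono AE_I2 order_trans[OF bound])
  qed simp
  have "(\<integral>\<omega>. W \<omega> * Z \<omega> \<partial>M) = (\<integral>\<omega>. W \<omega> * real_cond_exp M F Z \<omega> \<partial>M)"
    using real_cond_exp_intg(2)[OF int W Zm] by simp
  also have "\<dots> = (\<integral>\<omega>. m * W \<omega> \<partial>M)"
    using ce by (intro integral_cong_AE) auto
  finally show "(\<integral>\<omega>. W \<omega> * Z \<omega> \<partial>M) = m * (\<integral>\<omega>. W \<omega> \<partial>M)" by simp
qed

text \<open>The conditional mean \<open>m\<close> is common to all indices, so it factors out of the
  sum and multiplies the integral of the total weight, which is zero.\<close>

lemma (in prob_space) integral_zero_sum_weights:
  fixes W Z :: "'i \<Rightarrow> 'a \<Rightarrow> real"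
  assumes F: "sigma_finite_subalgebra M F"
    and W: "\<And>i. i \<in> I \<Longrightarrow> W i \<in> borel_measurable F"
    and bound: "\<And>i \<omega>. i \<in> I \<Longrightarrow> \<bar>W i \<omega>\<bar> \<le> K i"
    and Z: "\<And>i. i \<in> I \<Longrightarrow> integrable M (Z i)"
    and ce: "\<And>i. i \<in> I \<Longrightarrow> AE \<omega> in M. real_cond_exp M F (Z i) \<omega> = m"
    and zero: "\<And>\<omega>. (\<Sum>i\<in>I. W i \<omega>) = 0"
  shows "integrable M (\<lambda>\<omega>. \<Sum>i\<in>I. W i \<omega> * Z i \<omega>)" "(\<integral>\<omega>. (\<Sum>i\<in>I. W i \<omega> * Z i \<omega>) \<partial>M) = 0"
proof -
  note * = integral_weighted_const_cond_exp[OF F W bound Z ce]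
  show "integrable M (\<lambda>\<omega>. \<Sum>i\<in>I. W i \<omega> * Z i \<omega>)" using * by auto
  have sub: "subalgebra M F"
    using F by (simp add: sigma_finite_subalgebra_def)
  have Wint: "integrable M (W i)" if "i \<in> I" for i
    using that bound by (intro integrable_const_bound[where B = "K i"] AE_I2
        measurable_from_subalg[OF sub W]) auto
  have "(\<integral>\<omega>. (\<Sum>i\<in>I. W i \<omega> * Z i \<omega>) \<partial>M) = m * (\<integral>\<omega>. (\<Sum>i\<in>I. W i \<omega>) \<partial>M)"
    using * Wint by (simp add: sum_distrib_left)
  also have "\<dots> = 0" by (simp add: zero)
  finally show "(\<integral>\<omega>. (\<Sum>i\<in>I. W i \<omega> * Z i \<omega>) \<partial>M) = 0" .
qed

section \<open>Switch weights: algebra and bounds\<close>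

text \<open>
  The weight of group g in the period-t contrast of the groups that switch from b to a with the
  groups that stay at b. The convention for empty sets of groups is built into the weight.
\<close>

definition switch_weight ::
  "nat \<Rightarrow> nat \<Rightarrow> (nat \<Rightarrow> nat \<Rightarrow> nat) \<Rightarrow> (nat \<Rightarrow> nat \<Rightarrow> 'a \<Rightarrow> real)
     \<Rightarrow> real \<Rightarrow> real \<Rightarrow> nat \<Rightarrow> nat \<Rightarrow> 'a \<Rightarrow> real" where
  "switch_weight G T N Dc a b t g \<omega> =
     (if groups_path G Dc a b b t \<omega> = {} \<or> groups_path G Dc b b b t \<omega> = {} then 0
      else real (N_path G N Dc a b b t \<omega>) / real (N_S_pl G T N Dc \<omega>) *
        (real (N g t) / real (N_path G N Dc a b b t \<omega>) * of_bool (g \<in> groups_path G Dc a b b t \<omega>)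
       - real (N g t) / real (N_path G N Dc b b b t \<omega>) * of_bool (g \<in> groups_path G Dc b b b t \<omega>)))"

lemma finite_groups_path [simp]: "finite (groups_path G Dc d d1 d2 t \<omega>)"
  by (simp add: groups_path_def)

text \<open>Trades an index set that varies with \<open>\<omega>\<close> for a fixed one with
  indicators, so that sums can be handled term by term.\<close>

lemma sum_groups_path:
  fixes f :: "nat \<Rightarrow> 'b::semiring_1"
  shows "(\<Sum>g\<in>groups_path G Dc d d1 d2 t \<omega>. f g)
    = (\<Sum>g=1..G. f g * of_bool (g \<in> groups_path G Dc d d1 d2 t \<omega>))"
  by (rule sum.mono_neutral_cong_left) (auto simp: groups_path_def)

lemma N_path_pos:
  assumes "\<And>g. g \<in> {1..G} \<Longrightarrow> N g t > 0" "groups_path G Dc d d1 d2 t \<omega> \<noteq> {}"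
  shows "N_path G N Dc d d1 d2 t \<omega> > 0"
  unfolding N_path_def using assms by (intro sum_pos) (auto simp: groups_path_def)

text \<open>Switchers and stayers each receive weights normalised to total one, so their contrast
  totals zero. Positive cell sizes keep the normalising counts away from zero when both sets are
  nonempty; otherwise every weight is 0.\<close>

lemma sum_switch_weight:
  assumes "\<And>g. g \<in> {1..G} \<Longrightarrow> N g t > 0"
  shows "(\<Sum>g=1..G. switch_weight G T N Dc a b t g \<omega>) = 0"
proof -
  have "(\<Sum>g=1..G. real (N g t) / real (N_path G N Dc d d1 d2 t \<omega>) *
      of_bool (g \<in> groups_path G Dc d d1 d2 t \<omega>)) = 1"
    if ne: "groups_path G Dc d d1 d2 t \<omega> \<noteq> {}" for d d1 d2
  proof -
    have "N_path G N Dc d d1 d2 t \<omega> > 0"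
      using assms ne by (rule N_path_pos)
    then have "(\<Sum>g\<in>groups_path G Dc d d1 d2 t \<omega>. real (N g t) / real (N_path G N Dc d d1 d2 t \<omega>)) = 1"
      by (simp only: sum_divide_distrib[symmetric] of_nat_sum[symmetric] N_path_def[symmetric]) simp
    then show ?thesis by (simp only: sum_groups_path)
  qed
  note sum_eq_1 = this
  show ?thesis
  proof (cases "groups_path G Dc a b b t \<omega> = {} \<or> groups_path G Dc b b b t \<omega> = {}")
    case False
    with sum_eq_1[of a b b] sum_eq_1[of b b b] show ?thesis
      by (simp only: switch_weight_def if_False sum_distrib_left[symmetric] sum_subtractf
          de_Morgan_disj simp_thms diff_self mult_zero_right)
  qed (auto simp: switch_weight_def)
qed

text \<open>The weights always take switchers minus stayers, whereas \<open>DID_pl_minus\<close>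
  takes stayers minus switchers; hence the minus sign before the second sum.\<close>

lemma DID_pl_M_eq_sum_switch_weight:
  "DID_pl_M G T N Dc Yc \<omega> = (\<Sum>t=3..T.
     (\<Sum>g=1..G. switch_weight G T N Dc 1 0 t g \<omega> * (Yc g (t - 1) \<omega> - Yc g (t - 2) \<omega>))
   - (\<Sum>g=1..G. switch_weight G T N Dc 0 1 t g \<omega> * (Yc g (t - 1) \<omega> - Yc g (t - 2) \<omega>)))"
proof -
  have eq: "(\<Sum>g=1..G. switch_weight G T N Dc a b t g \<omega> * (Yc g (t - 1) \<omega> - Yc g (t - 2) \<omega>)) =
      (if groups_path G Dc a b b t \<omega> = {} \<or> groups_path G Dc b b b t \<omega> = {} then 0
       else real (N_path G N Dc a b b t \<omega>) / real (N_S_pl G T N Dc \<omega>) *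
         (path_mean_lagged_diff G N Dc Yc a b b t \<omega> - path_mean_lagged_diff G N Dc Yc b b b t \<omega>))"
    for a b t
  proof -
    \<comment> \<open>Moves the outcome difference in front of the indicators, the shape that
      \<open>sum_groups_path\<close> produces from \<open>path_mean_lagged_diff\<close>.\<close>
    have sw: "(c * (x * i - y * j)) * z = c * (x * z * i - y * z * j)" for c x y z i j :: real
      by (simp add: algebra_simps)
    show ?thesis
    proof (cases "groups_path G Dc a b b t \<omega> = {} \<or> groups_path G Dc b b b t \<omega> = {}")
      case False
      then show ?thesis
        by (simp only: switch_weight_def path_mean_lagged_diff_def sum_groups_path if_False
            sw sum_subtractf sum_distrib_left[symmetric])
    qed (auto simp: switch_weight_def)
  qed
  show ?thesis
    unfolding DID_pl_M_def DID_pl_plus_def DID_pl_minus_def eq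
    by (intro sum.cong refl) (auto simp: algebra_simps add_divide_distrib diff_divide_distrib)
qed

text \<open>For \<open>n = 0\<close> the quotient is 0 by convention. This lets the next bound hold
  at every \<open>\<omega>\<close>, including those where \<open>N_S_pl\<close> is 0.\<close>

lemma real_divide_nat_le: "real a / real n \<le> real a"
  using mult_left_mono[of 1 "real n" "real a"] by (cases "n = 0") (auto simp: field_simps)

text \<open>The leading factor is at most the total size of period \<open>t\<close>, and the two
  normalised terms both lie between 0 and \<open>N g t\<close>. A crude bound suffices, since it
  only serves integrability.\<close>

lemma abs_switch_weight_le:
  "\<bar>switch_weight G T N Dc a b t g \<omega>\<bar> \<le> real (\<Sum>g=1..G. N g t) * real (N g t)"
proof -
  let ?x = "\<lambda>a. real (N g t) / real (N_path G N Dc a b b t \<omega>) * of_bool (g \<in> groups_path G Dc a b b t \<omega>)"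
  have x: "0 \<le> ?x a \<and> ?x a \<le> real (N g t)" for a
    by (simp add: real_divide_nat_le)
  have "N_path G N Dc a b b t \<omega> \<le> (\<Sum>g=1..G. N g t)"
    unfolding N_path_def by (intro sum_mono2) (auto simp: groups_path_def)
  then have "real (N_path G N Dc a b b t \<omega>) / real (N_S_pl G T N Dc \<omega>) \<le> real (\<Sum>g=1..G. N g t)"
    by (meson real_divide_nat_le of_nat_le_iff order_trans)
  moreover have "\<bar>?x a - ?x b\<bar> \<le> real (N g t)"
    using x[of a] x[of b] by linarith
  ultimately have "\<bar>real (N_path G N Dc a b b t \<omega>) / real (N_S_pl G T N Dc \<omega>) * (?x a - ?x b)\<bar>
      \<le> real (\<Sum>g=1..G. N g t) * real (N g t)"
    unfolding abs_mult by (intro mult_mono) (auto intro: sum_nonneg)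
  moreover have "0 \<le> real (\<Sum>g=1..G. N g t) * real (N g t)"
    by (intro mult_nonneg_nonneg of_nat_0_le_iff)
  ultimately show ?thesis
    unfolding switch_weight_def by (smt (verit))
qed

section \<open>Measurability of weights and outcomes\<close>

lemma switch_weight_measurable:
  assumes Dc: "\<And>g t. g \<in> {1..G} \<Longrightarrow> t \<in> {1..T} \<Longrightarrow> Dc g t \<in> borel_measurable F"
    and t: "t \<in> {3..T}"
  shows "switch_weight G T N Dc a b t g \<in> borel_measurable F"
proof -
  have eq: "Measurable.pred F (\<lambda>\<omega>. X \<omega> = c)"
    if "X \<in> borel_measurable F" for X and c :: real
    using that by (rule pred_eq_const1) simp
  have mem[measurable]: "Measurable.pred F (\<lambda>\<omega>. h \<in> groups_path G Dc d d1 d2 t \<omega>)" for h d d1 d2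
  proof (cases "h \<in> {1..G}")
    case True
    \<comment> \<open>With \<open>t\<close> at least 3, truncated subtraction is harmless and both
      lags stay among the periods where \<open>Dc\<close> is known to be measurable.\<close>
    have "t \<in> {1..T}" "t - 1 \<in> {1..T}" "t - 2 \<in> {1..T}" using t by auto
    note Dc_h = this[THEN Dc[OF True]]
    have "Measurable.pred F (\<lambda>\<omega>. Dc h t \<omega> = d \<and> Dc h (t - 1) \<omega> = d1 \<and> Dc h (t - 2) \<omega> = d2)"
      by (intro pred_intros_logic(3) eq Dc_h)
    with True show ?thesis by (simp add: groups_path_def)
  next
    case False
    then have "(\<lambda>\<omega>. h \<in> groups_path G Dc d d1 d2 t \<omega>) = (\<lambda>\<omega>. False)"
      by (auto simp: groups_path_def fun_eq_iff)
    then show ?thesis by (simp only: measurable_const space_count_space UNIV_I)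
  qed
  \<comment> \<open>Turns emptiness of a random set into a finite conjunction of membership events,
    which are already known to be measurable.\<close>
  have empty: "groups_path G Dc d d1 d2 t \<omega> = {} \<longleftrightarrow> (\<forall>h\<in>{1..G}. h \<notin> groups_path G Dc d d1 d2 t \<omega>)"
    for d d1 d2 \<omega> by (auto simp: groups_path_def)
  have [measurable]: "(\<lambda>\<omega>. real (N_path G N Dc d d1 d2 t \<omega>)) \<in> borel_measurable F" for d d1 d2
    unfolding N_path_def of_nat_sum sum_groups_path[of "\<lambda>g. real (N g t)"] by measurable
  have NS: "real (N_S_pl G T N Dc \<omega>) = (\<Sum>(g, t)\<in>{1..G} \<times> {3..T}.
      real (N g t) * of_bool (Dc g t \<omega> \<noteq> Dc g (t - 1) \<omega> \<and> Dc g (t - 1) \<omega> = Dc g (t - 2) \<omega>))" for \<omega>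
    unfolding N_S_pl_def of_nat_sum
    by (rule sum.mono_neutral_cong_left) auto
  have [measurable]: "(\<lambda>\<omega>. real (N_S_pl G T N Dc \<omega>)) \<in> borel_measurable F"
    unfolding NS
  proof (intro borel_measurable_sum, clarify)
    fix g t assume "g \<in> {1..G}" "t \<in> {3..T}"
    then have Dc_g: "Dc g t \<in> borel_measurable F" "Dc g (t - 1) \<in> borel_measurable F"
      "Dc g (t - 2) \<in> borel_measurable F" by (auto intro!: Dc)
    have eq': "Measurable.pred F (\<lambda>\<omega>. Dc g s \<omega> = Dc g s' \<omega>)"
      if "Dc g s \<in> borel_measurable F" "Dc g s' \<in> borel_measurable F" for s s'
      using eq[OF borel_measurable_diff[OF that], of 0] by simp
    have "Measurable.pred F (\<lambda>\<omega>. Dc g t \<omega> \<noteq> Dc g (t - 1) \<omega> \<and> Dc g (t - 1) \<omega> = Dc g (t - 2) \<omega>)"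
      by (intro pred_intros_logic(2,3) eq' Dc_g)
    note [measurable] = this
    show "(\<lambda>\<omega>. real (N g t) * of_bool (Dc g t \<omega> \<noteq> Dc g (t - 1) \<omega> \<and> Dc g (t - 1) \<omega> = Dc g (t - 2) \<omega>))
        \<in> borel_measurable F" by measurable
  qed
  show ?thesis
    unfolding switch_weight_def empty by measurable
qed

lemma cell_treatment_sigma_all_measurable:
  assumes "g \<in> {1..G}" "t \<in> {1..T}"
  shows "Dc g t \<in> borel_measurable (sigma_all M G T Dc)"
proof -
  let ?f = "\<lambda>\<omega>. \<lambda>(g, t)\<in>{1..G} \<times> {1..T}. Dc g t \<omega>"
  have "?f \<in> sigma_all M G T Dc \<rightarrow>\<^sub>M (\<Pi>\<^sub>M p\<in>{1..G} \<times> {1..T}. borel)"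
    unfolding sigma_all_def by (rule measurable_vimage_algebra1) (auto simp: space_PiM)
  then have "(\<lambda>\<omega>. ?f \<omega> (g, t)) \<in> borel_measurable (sigma_all M G T Dc)"
    by (rule measurable_compose) (rule measurable_component_singleton, use assms in auto)
  then show ?thesis using assms by simp
qed

lemma cell_avg_measurable:
  assumes "\<And>i. i \<in> {1..N g t} \<Longrightarrow> X i g t \<in> borel_measurable M"
  shows "cell_avg N X g t \<in> borel_measurable M"
  unfolding cell_avg_def using assms by (intro borel_measurable_divide borel_measurable_sum) auto

lemma observed_outcome_measurable:
  assumes D: "D i g t \<in> M \<rightarrow>\<^sub>M count_space {0, 1}"
    and Y: "Y i g t 0 \<in> borel_measurable M" "Y i g t 1 \<in> borel_measurable M"
  shows "observed_outcome D Y i g t \<in> borel_measurable M"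
proof -
  \<comment> \<open>The treatment is known to be 0 or 1 only on \<open>space M\<close>, so the case
    split is asserted only there.\<close>
  have eq: "observed_outcome D Y i g t \<omega> = (if D i g t \<omega> \<in> {0} then Y i g t 0 \<omega> else Y i g t 1 \<omega>)"
    if "\<omega> \<in> space M" for \<omega>
    using measurable_space[OF D that] by (auto simp: observed_outcome_def)
  have "Measurable.pred M (\<lambda>\<omega>. D i g t \<omega> \<in> {0})"
    using measurable_sets[OF D, of "{0}"] by (simp add: pred_def vimage_def Int_def conj_commute)
  then show ?thesis
    using Y by (subst measurable_cong[OF eq]) (auto intro!: measurable_If simp: pred_def)
qed

section \<open>From observed to potential outcomes\<close>

lemma cell_outcome_eq_potential:
  assumes "\<And>i. i \<in> {1..N g t} \<Longrightarrow> real (D i g t \<omega>) = cell_treatment N D g t \<omega>"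
    and "cell_treatment N D g t \<omega> = real d"
  shows "cell_outcome N D Y g t \<omega> = cell_potential N Y d g t \<omega>"
proof -
  have "D i g t \<omega> = d" if "i \<in> {1..N g t}" for i
    using assms that by (metis of_nat_eq_iff)
  then show ?thesis
    unfolding cell_outcome_def cell_potential_def cell_avg_def observed_outcome_def
    by (intro arg_cong2[where f = divide] sum.cong) auto
qed

text \<open>Switchers and stayers can differ only in period \<open>t\<close>; their two earlier
  treatments are both \<open>b\<close>. This is what identifies the potential outcome observed in
  the lagged periods.\<close>

lemma switch_weight_nonzeroD:
  assumes "switch_weight G T N Dc a b t g \<omega> \<noteq> 0"
  shows "Dc g (t - 1) \<omega> = b" "Dc g (t - 2) \<omega> = b"
proof -
  have "g \<in> groups_path G Dc a b b t \<omega> \<or> g \<in> groups_path G Dc b b b t \<omega>"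
    using assms by (rule contrapos_np) (auto simp: switch_weight_def)
  then show "Dc g (t - 1) \<omega> = b" "Dc g (t - 2) \<omega> = b" by (auto simp: groups_path_def)
qed

text \<open>Integrability is part of the conclusion because the Bochner integral of a non-integrable
  function is 0 by convention, so the equation alone would not express a mean of zero.\<close>

theorem theorem4:
  fixes M :: "'a measure"
    and G T :: nat
    and N :: "nat \<Rightarrow> nat \<Rightarrow> nat"
    and D :: "nat \<Rightarrow> nat \<Rightarrow> nat \<Rightarrow> 'a \<Rightarrow> nat"
    and Y :: "nat \<Rightarrow> nat \<Rightarrow> nat \<Rightarrow> nat \<Rightarrow> 'a \<Rightarrow> real"
  assumes prob: "prob_space M"
    and T_ge: "T \<ge> 3"
    and binary_treatment:
      "\<And>i g t. \<lbrakk>g \<in> {1..G}; t \<in> {1..T}; i \<in> {1..N g t}\<rbrakk>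
         \<Longrightarrow> D i g t \<in> M \<rightarrow>\<^sub>M count_space {0, 1}"
    and finite_expectation:
      "\<And>i g t d. \<lbrakk>g \<in> {1..G}; t \<in> {1..T}; i \<in> {1..N g t}; d \<in> {0, 1}\<rbrakk>
         \<Longrightarrow> integrable M (Y i g t d)"
    and switchers: "AE \<omega> in M. N_S_pl G T N (cell_treatment N D) \<omega> > 0"
    and balanced_panel:
      "\<And>g t. \<lbrakk>g \<in> {1..G}; t \<in> {1..T}\<rbrakk> \<Longrightarrow> N g t > 0"
    and sharp_design:
      "AE \<omega> in M. \<forall>g\<in>{1..G}. \<forall>t\<in>{1..T}. \<forall>i\<in>{1..N g t}.
         real (D i g t \<omega>) = cell_treatment N D g t \<omega>"
    and strong_exogeneity:
      "\<And>d g t. \<lbrakk>d \<in> {0, 1}; g \<in> {1..G}; t \<in> {2..T}\<rbrakk> \<Longrightarrow>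
         AE \<omega> in M.
           real_cond_exp M (sigma_group M T (cell_treatment N D) g)
             (\<lambda>\<omega>'. cell_potential N Y d g t \<omega>' - cell_potential N Y d g (t - 1) \<omega>') \<omega>
           = (\<integral>\<omega>'. cell_potential N Y d g t \<omega>' - cell_potential N Y d g (t - 1) \<omega>' \<partial>M)"
    and common_trends:
      "\<And>d t g g'. \<lbrakk>d \<in> {0, 1}; t \<in> {2..T}; g \<in> {1..G}; g' \<in> {1..G}\<rbrakk> \<Longrightarrow>
         (\<integral>\<omega>. cell_potential N Y d g t \<omega> - cell_potential N Y d g (t - 1) \<omega> \<partial>M)
         = (\<integral>\<omega>. cell_potential N Y d g' t \<omega> - cell_potential N Y d g' (t - 1) \<omega> \<partial>M)"
    and mean_independence:
      "\<And>d g t. \<lbrakk>d \<in> {0, 1}; g \<in> {1..G}; t \<in> {1..T}\<rbrakk> \<Longrightarrow>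
         AE \<omega> in M.
           real_cond_exp M (sigma_all M G T (cell_treatment N D)) (cell_potential N Y d g t) \<omega>
           = real_cond_exp M (sigma_group M T (cell_treatment N D) g) (cell_potential N Y d g t) \<omega>"
    and stable_groups_0:
      "AE \<omega> in M. \<forall>t\<in>{3..T}. \<forall>g\<in>groups_path G (cell_treatment N D) 1 0 0 t \<omega>.
         \<exists>g'\<in>groups_path G (cell_treatment N D) 0 0 0 t \<omega>. g' \<noteq> g"
    and stable_groups_1:
      "AE \<omega> in M. \<forall>t\<in>{3..T}. \<forall>g\<in>groups_path G (cell_treatment N D) 0 1 1 t \<omega>.
         \<exists>g'\<in>groups_path G (cell_treatment N D) 1 1 1 t \<omega>. g' \<noteq> g"
  shows "integrable M (DID_pl_M G T N (cell_treatment N D) (cell_outcome N D Y))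
       \<and> (\<integral>\<omega>. DID_pl_M G T N (cell_treatment N D) (cell_outcome N D Y) \<omega> \<partial>M) = 0"
proof -
  interpret prob_space M by (rule prob)
  define Dc where "Dc = cell_treatment N D"
  define Yc where "Yc = cell_outcome N D Y"
  define P where "P = cell_potential N Y"
  define Z where "Z = (\<lambda>d t g \<omega>. P d g t \<omega> - P d g (t - 1) \<omega>)"
  define W where "W = switch_weight G T N Dc"
  let ?F = "sigma_all M G T Dc"

  have Dc_meas: "Dc g t \<in> borel_measurable M" if "g \<in> {1..G}" "t \<in> {1..T}" for g t
    unfolding Dc_def cell_treatment_def
    using measurable_compose[OF binary_treatment[OF that], of _ real]
    by (intro cell_avg_measurable) auto
  have Yc_meas: "Yc g t \<in> borel_measurable M" if "g \<in> {1..G}" "t \<in> {1..T}" for g t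
    unfolding Yc_def cell_outcome_def
    by (intro cell_avg_measurable observed_outcome_measurable binary_treatment
        borel_measurable_integrable finite_expectation that) auto
  have P_int: "integrable M (P d g t)" if "d \<in> {0, 1}" "g \<in> {1..G}" "t \<in> {1..T}" for d g t
    unfolding P_def cell_potential_def cell_avg_def
    using that by (intro integrable_divide Bochner_Integration.integrable_sum finite_expectation)
  have Z_int: "integrable M (Z d t g)" if "d \<in> {0, 1}" "g \<in> {1..G}" "t \<in> {2..T}" for d g t
    unfolding Z_def using that by (intro Bochner_Integration.integrable_diff P_int) auto

  have F: "sigma_finite_subalgebra M ?F"
    unfolding sigma_all_def
    by (intro sigma_finite_subalgebra_vimage_algebra measurable_restrict) (auto intro: Dc_meas)
  have Fg: "sigma_finite_subalgebra M (sigma_group M T Dc g)" if "g \<in> {1..G}" for g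
    unfolding sigma_group_def
    using that by (intro sigma_finite_subalgebra_vimage_algebra measurable_restrict Dc_meas) auto

  \<comment> \<open>Mean independence in periods \<open>t\<close> and \<open>t - 1\<close>, with
    linearity, reduces conditioning on all treatments to conditioning on those of group
    \<open>g\<close>. Strong exogeneity then gives the unconditional mean, and common trends equates
    it with that of group 1, an arbitrary reference group that exists because \<open>g\<close>
    does.\<close>
  have Z_ce: "AE \<omega> in M. real_cond_exp M ?F (Z d t g) \<omega> = (\<integral>\<omega>. Z d t 1 \<omega> \<partial>M)"
    if d: "d \<in> {0, 1}" and g: "g \<in> {1..G}" and t: "t \<in> {2..T}" for d g t
  proof -
    have t': "t \<in> {1..T}" "t - 1 \<in> {1..T}" using t by auto
    note int = P_int[OF d g t'(1)] P_int[OF d g t'(2)]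
    note indep = mean_independence[OF d g, folded Dc_def P_def]
    have mean: "(\<integral>\<omega>. Z d t g \<omega> \<partial>M) = (\<integral>\<omega>. Z d t 1 \<omega> \<partial>M)"
      using common_trends[OF d t g, of 1] g by (auto simp: Z_def P_def)
    from sigma_finite_subalgebra.real_cond_exp_diff[OF F int]
      sigma_finite_subalgebra.real_cond_exp_diff[OF Fg[OF g] int]
      indep[OF t'(1)] indep[OF t'(2)] strong_exogeneity[OF d g t, folded Dc_def P_def]
    show ?thesis unfolding mean[symmetric] unfolding Z_def by eventually_elim simp
  qed

  have term_zero: "integrable M (\<lambda>\<omega>. \<Sum>g=1..G. W a (real b) t g \<omega> * (Yc g (t - 1) \<omega> - Yc g (t - 2) \<omega>))
      \<and> (\<integral>\<omega>. (\<Sum>g=1..G. W a (real b) t g \<omega> * (Yc g (t - 1) \<omega> - Yc g (t - 2) \<omega>)) \<partial>M) = 0"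
    (is "integrable M ?S \<and> _") if b: "b \<in> {0, 1}" and t: "t \<in> {3..T}" for a b t
  proof -
    let ?S' = "\<lambda>\<omega>. \<Sum>g=1..G. W a (real b) t g \<omega> * Z b (t - 1) g \<omega>"
    \<comment> \<open>The estimator uses the change from \<open>t - 2\<close> to
      \<open>t - 1\<close>, so the trend assumptions are applied in period \<open>t - 1\<close>,
      which lies in \<open>{2..T}\<close>.\<close>
    have t': "t \<in> {1..T}" "t - 1 \<in> {1..T}" "t - 2 \<in> {1..T}" "t - 1 \<in> {2..T}" "t - 1 - 1 = t - 2"
      using t by auto
    have W_meas: "W a (real b) t g \<in> borel_measurable ?F" for g
      unfolding W_def by (intro switch_weight_measurable cell_treatment_sigma_all_measurable t)
    have W_sum: "(\<Sum>g=1..G. W a (real b) t g \<omega>) = 0" for \<omega>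
      unfolding W_def by (rule sum_switch_weight) (rule balanced_panel[OF _ t'(1)])
    have W_bound: "\<bar>W a (real b) t g \<omega>\<bar> \<le> real (\<Sum>g=1..G. N g t) * real (N g t)" for g \<omega>
      unfolding W_def by (rule abs_switch_weight_le)
    note S' = integral_zero_sum_weights[OF F W_meas W_bound
        Z_int[OF b _ t'(4)] Z_ce[OF b _ t'(4)] W_sum]
    have W_measM: "W a (real b) t g \<in> borel_measurable M" for g
      using W_meas F measurable_from_subalg sigma_finite_subalgebra.subalg by blast
    \<comment> \<open>Shown directly from the observed outcomes: \<open>?S\<close> and
      \<open>?S'\<close> agree only almost surely, which does not by itself transfer
      measurability.\<close>
    have S_meas: "?S \<in> borel_measurable M"
      using t' by (intro borel_measurable_sum borel_measurable_times borel_measurable_diff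
          W_measM Yc_meas) auto
    \<comment> \<open>Where the weight is 0 both terms vanish. Elsewhere group \<open>g\<close> has
      treatment \<open>b\<close> in both lagged periods, and the sharp design makes its observed
      outcomes the potential ones under \<open>b\<close>.\<close>
    have eq: "AE \<omega> in M. ?S \<omega> = ?S' \<omega>"
      using sharp_design
    proof eventually_elim
      case (elim \<omega>)
      have "W a (real b) t g \<omega> * (Yc g (t - 1) \<omega> - Yc g (t - 2) \<omega>)
          = W a (real b) t g \<omega> * Z b (t - 1) g \<omega>" if g: "g \<in> {1..G}" for g
      proof (cases "W a (real b) t g \<omega> = 0")
        case False
        note path = switch_weight_nonzeroD[OF False[unfolded W_def]]
        have "Yc g s \<omega> = P b g s \<omega>" if "s \<in> {1..T}" "Dc g s \<omega> = real b" for s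
          unfolding Yc_def P_def using elim g that
          by (intro cell_outcome_eq_potential) (auto simp: Dc_def)
        with path t' show ?thesis by (simp add: Z_def)
      qed simp
      then show ?case by (intro sum.cong) auto
    qed
    show ?thesis
      using integrable_cong_AE[OF S_meas _ eq] integral_cong_AE[OF S_meas _ eq] S'
        borel_measurable_integrable[OF S'(1)] by simp
  qed
  \<comment> \<open>\<open>has_bochner_integral\<close> carries integrability and value together, so
    linearity over periods and switch types yields both conclusions at once.\<close>
  have zero: "has_bochner_integral M
      (\<lambda>\<omega>. \<Sum>g=1..G. W a (real b) t g \<omega> * (Yc g (t - 1) \<omega> - Yc g (t - 2) \<omega>)) 0"
    if "b \<in> {0, 1}" "t \<in> {3..T}" for a b t
    using term_zero[OF that] by (simp only: has_bochner_integral_iff)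
  have "has_bochner_integral M (DID_pl_M G T N Dc Yc) (\<Sum>t=3..T. 0 - 0)"
    unfolding DID_pl_M_eq_sum_switch_weight[abs_def] W_def[symmetric]
    by (intro has_bochner_integral_sum has_bochner_integral_diff
        zero[of 0, unfolded of_nat_0] zero[of 1, unfolded of_nat_1]) auto
  then show ?thesis by (simp add: Dc_def Yc_def has_bochner_integral_iff)
qed

end
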